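(* If a language $L$ is recognized by a realtime deterministic one-reversal one-counter automaton (1-rev-RT-D1CA), then $L$ is recognized by some realtime quantum finite automaton with an increment-only counter (RT-QFA-IOC) with (strict) cutpoint $\frac12$.
   Context: Realtime processing: for an input $w\in\Sigma^*$ (where $\Sigma$ is a finite alphabet not containing the end-markers ¢, \$), the input tape contains $\tilde w=$ ¢$w$\$. The machine reads $\tilde w$ from left to right, one symbol per step, and decides right after reading \$. Put $\tilde\Sigma=\Sigma\cup\{\text{¢},\$\}$. RT-D1CA: a tuple $(Q,\Sigma,\delta,q_1,Q_a)$ with finite state set $Q$, initial state $q_1$, accepting states $Q_a\subseteq Q$, a counter that holds an integer (initially $0$), and a function $D_c:Q\to\{-1,0,+1\}$. In each step the next state $q'$ is determined by the current state, the scanned symbol $\sigma\in\tilde\Sigma$ and the counter status $\theta\in\{0,1\}$ ($\theta=0$ if the counter value is zero, $\theta=1$ if it is nonzero), and the counter is then updated by adding $D_c(q')$. The input is accepted iff the state after processing \$ is in $Q_a$; the recognized language is the set of accepted strings. It is a 1-rev-RT-D1CA if the number of alternations from increasing to decreasing and vice versa on the counter is at most $1$. RT-QFA-IOC: a tuple $(Q,\Sigma,\Omega,\delta,q_1,Q_a)$ with finite state set $Q$, initial state $q_1$, accepting states $Q_a\subseteq Q$, and finite register alphabet $\Omega$. In state $q$ reading $\sigma\in\tilde\Sigma$, the machine moves to $q'$, adds $c\in\{0,+1\}$ to its counter (initially $0$, never checked) and writes $\omega\in\Omega$ in the register with amplitude $\delta(q,\sigma,q',c,\omega)\in\mathbb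 C$. A configuration consists of the state, the input head position and the counter value (the register is not part of it, and is reset to a fixed initial symbol before every step). For a given input let $\mathcal C$ be the set of attainable configurations, and for $\omega\in\Omega$ let $E_\omega$ be the matrix of one-step amplitudes between configurations with $\omega$ written in the register. The machine must be well-formed: $\sum_{\omega}E_\omega^\dagger E_\omega=I$ for every input. The state evolves from the initial configuration by $\rho\mapsto\sum_\omega E_\omega\rho E_\omega^\dagger$ in each step, and $f_{\mathcal M}(w)$ is the probability that, after \$ is processed, a measurement of the internal state gives a state in $Q_a$. $L$ is recognized by $\mathcal M$ with (strict) cutpoint $\lambda\in\mathbb R$ if $L=\{w\in\Sigma^*: f_{\mathcal M}(w)>\lambda\}$. *)

theory Defs
  imports Complex_Main
begin

datatype 'a tape_sym = LeftEnd | Sym 'a | RightEnd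

definition tape :: "'a list \<Rightarrow> 'a tape_sym list" where
  "tape w = LeftEnd # map Sym w @ [RightEnd]"

definition tape_syms :: "'a set \<Rightarrow> 'a tape_sym set" where
  "tape_syms A = insert LeftEnd (insert RightEnd (Sym ` A))"


section \<open>Realtime deterministic one-counter automata\<close>

text \<open>The boolean argument of the transition function is the counter status; it is true iff the
  counter is nonzero.\<close>

record ('q, 'a) d1ca =
  dc_states :: "'q set"
  dc_alphabet :: "'a set"
  dc_delta :: "'q \<Rightarrow> 'a tape_sym \<Rightarrow> bool \<Rightarrow> 'q"
  dc_init :: 'q
  dc_accept :: "'q set"
  dc_update :: "'q \<Rightarrow> int"

definition rt_d1ca :: "('q, 'a) d1ca \<Rightarrow> bool" where
  "rt_d1ca M \<longleftrightarrow>
     finite (dc_states M) \<and> finite (dc_alphabet M) \<and>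
     dc_init M \<in> dc_states M \<and> dc_accept M \<subseteq> dc_states M \<and>
     (\<forall>q\<in>dc_states M. \<forall>\<sigma>\<in>tape_syms (dc_alphabet M). \<forall>\<theta>. dc_delta M q \<sigma> \<theta> \<in> dc_states M) \<and>
     (\<forall>q\<in>dc_states M. dc_update M q \<in> {-1, 0, 1})"

definition dc_step :: "('q, 'a) d1ca \<Rightarrow> 'q \<times> int \<Rightarrow> 'a tape_sym \<Rightarrow> 'q \<times> int" where
  "dc_step M = (\<lambda>(q, v) \<sigma>. let q' = dc_delta M q \<sigma> (v \<noteq> 0) in (q', v + dc_update M q'))"

definition dc_run :: "('q, 'a) d1ca \<Rightarrow> 'a tape_sym list \<Rightarrow> 'q \<times> int" where
  "dc_run M t = foldl (dc_step M) (dc_init M, 0) t"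

definition dc_lang :: "('q, 'a) d1ca \<Rightarrow> 'a list set" where
  "dc_lang M = {w \<in> lists (dc_alphabet M). fst (dc_run M (tape w)) \<in> dc_accept M}"

definition dc_changes :: "('q, 'a) d1ca \<Rightarrow> 'a tape_sym list \<Rightarrow> int list" where
  "dc_changes M t = map (\<lambda>i. snd (dc_run M (take (Suc i) t)) - snd (dc_run M (take i t))) [0..<length t]"

text \<open>Steps that leave the counter unchanged neither cause nor hide an alternation.\<close>

definition alternations :: "int list \<Rightarrow> nat" where
  "alternations ds =
     (let xs = filter (\<lambda>d. d \<noteq> 0) ds
      in card {i. Suc i < length xs \<and> sgn (xs ! i) \<noteq> sgn (xs ! Suc i)})"

definition one_rev_rt_d1ca :: "('q, 'a) d1ca \<Rightarrow> bool" where
  "one_rev_rt_d1ca M \<longleftrightarrow>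
     rt_d1ca M \<and> (\<forall>w\<in>lists (dc_alphabet M). alternations (dc_changes M (tape w)) \<le> 1)"


section \<open>Realtime quantum finite automata with an increment-only counter\<close>

record ('q, 'a, 'r) qfa_ioc =
  qc_states :: "'q set"
  qc_alphabet :: "'a set"
  qc_registers :: "'r set"
  qc_delta :: "'q \<Rightarrow> 'a tape_sym \<Rightarrow> 'q \<Rightarrow> nat \<Rightarrow> 'r \<Rightarrow> complex"
  qc_init :: 'q
  qc_accept :: "'q set"

text \<open>A configuration consists of the state, the number of tape symbols read so far (the head
  position), and the counter value.\<close>

type_synonym 'q qc_conf = "'q \<times> nat \<times> nat"

inductive_set qc_attainable :: "('q, 'a, 'r) qfa_ioc \<Rightarrow> 'a tape_sym list \<Rightarrow> 'q qc_conf set"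
  for M :: "('q, 'a, 'r) qfa_ioc" and t :: "'a tape_sym list" where
  init: "(qc_init M, 0, 0) \<in> qc_attainable M t"
| step: "\<lbrakk>(q, i, v) \<in> qc_attainable M t; i < length t;
          q' \<in> qc_states M; c \<in> {0, 1}; \<omega> \<in> qc_registers M;
          qc_delta M q (t ! i) q' c \<omega> \<noteq> 0\<rbrakk>
         \<Longrightarrow> (q', Suc i, v + c) \<in> qc_attainable M t"

text \<open>Matrices over configurations are functions of a row index and a column index, so
  \<open>qc_E M t \<omega> b a\<close> is the amplitude of the step from \<open>a\<close> to \<open>b\<close>.\<close>

definition qc_E :: "('q, 'a, 'r) qfa_ioc \<Rightarrow> 'a tape_sym list \<Rightarrow> 'r \<Rightarrow>
    'q qc_conf \<Rightarrow> 'q qc_conf \<Rightarrow> complex" where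
  "qc_E M t \<omega> = (\<lambda>(q', i', v') (q, i, v).
     if i < length t \<and> i' = Suc i \<and> (v' = v \<or> v' = v + 1)
     then qc_delta M q (t ! i) q' (v' - v) \<omega> else 0)"

text \<open>Configurations whose head has already passed the right end-marker make no further step; they
  only occur as results. The identity is therefore required on the attainable configurations in
  which a symbol is still to be read.\<close>

definition qc_well_formed :: "('q, 'a, 'r) qfa_ioc \<Rightarrow> bool" where
  "qc_well_formed M \<longleftrightarrow>
     (\<forall>w\<in>lists (qc_alphabet M).
       let t = tape w; C = qc_attainable M t; D = {(q, i, v) \<in> C. i < length t}
       in \<forall>a\<in>D. \<forall>b\<in>D.
            (\<Sum>\<omega>\<in>qc_registers M. \<Sum>c\<in>C. cnj (qc_E M t \<omega> c a) * qc_E M t \<omega> c b)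
              = (if a = b then 1 else 0))"

definition rt_qfa_ioc :: "('q, 'a, 'r) qfa_ioc \<Rightarrow> bool" where
  "rt_qfa_ioc M \<longleftrightarrow>
     finite (qc_states M) \<and> finite (qc_alphabet M) \<and> finite (qc_registers M) \<and>
     qc_init M \<in> qc_states M \<and> qc_accept M \<subseteq> qc_states M \<and> qc_well_formed M"

definition qc_evolve :: "('q, 'a, 'r) qfa_ioc \<Rightarrow> 'a tape_sym list \<Rightarrow>
    ('q qc_conf \<Rightarrow> 'q qc_conf \<Rightarrow> complex) \<Rightarrow> 'q qc_conf \<Rightarrow> 'q qc_conf \<Rightarrow> complex" where
  "qc_evolve M t \<rho> = (\<lambda>a b.
     \<Sum>\<omega>\<in>qc_registers M. \<Sum>c\<in>qc_attainable M t. \<Sum>d\<in>qc_attainable M t.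
       qc_E M t \<omega> a c * \<rho> c d * cnj (qc_E M t \<omega> b d))"

definition qc_initial :: "('q, 'a, 'r) qfa_ioc \<Rightarrow> 'q qc_conf \<Rightarrow> 'q qc_conf \<Rightarrow> complex" where
  "qc_initial M = (\<lambda>a b. if a = (qc_init M, 0, 0) \<and> b = (qc_init M, 0, 0) then 1 else 0)"

definition qc_prob :: "('q, 'a, 'r) qfa_ioc \<Rightarrow> 'a list \<Rightarrow> real" where
  "qc_prob M w =
     (let t = tape w; \<rho> = (qc_evolve M t ^^ length t) (qc_initial M)
      in Re (\<Sum>a\<in>{(q, i, v) \<in> qc_attainable M t. q \<in> qc_accept M}. \<rho> a a))"

definition qc_recognizes_with_cutpoint ::
    "('q, 'a, 'r) qfa_ioc \<Rightarrow> real \<Rightarrow> 'a list set \<Rightarrow> bool" where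
  "qc_recognizes_with_cutpoint M \<kappa> L \<longleftrightarrow>
     L = {w \<in> lists (qc_alphabet M). qc_prob M w > \<kappa>}"

text \<open>The sums over attainable configurations are sums over finite sets.\<close>

lemma finite_qc_attainable:
  assumes "finite (qc_states M)" and "qc_init M \<in> qc_states M"
  shows "finite (qc_attainable M t)"
proof (rule finite_subset)
  have "q \<in> qc_states M \<and> i \<le> length t \<and> v \<le> i" if "(q, i, v) \<in> qc_attainable M t" for q i v
    using that by (induction q i v rule: qc_attainable.induct) (use assms in auto)
  then show "qc_attainable M t \<subseteq> qc_states M \<times> {..length t} \<times> {..length t}"
    by fastforce
  show "finite (qc_states M \<times> {..length t} \<times> {..length t})"
    using assms by simp
qed

end

theory Submission
  imports Defs
begin

text \<open>While the counter of the automaton is still zero, it is simulated deterministically. At the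
  first nonzero update the simulation splits into two paths of equal amplitude, one counting the
  increments and the other the decrements, which pretend that the counter never returns to zero.
  In every step each path keeps amplitude \<open>1 / sqrt 3\<close> and spends the rest on the hypothesis that the
  counter has just returned to zero. From then on no second return is possible, so the finite control
  knows how the automaton ends. The hypothesis is split into an answer branch and an opposite-answer
  branch, the latter with opposite signs on the two paths. If the two counts agree, the amplitudes
  cancel on the opposite branch, and the hypothesis shifts the acceptance probability away from
  \<open>1 / 2\<close> in the right direction; if they differ, the two branches balance. A correct hypothesis has
  weight \<open>2 / 3\<close> of what was left, hence it outweighs everything that comes later.\<close>

section \<open>The Heisenberg picture\<close>

text \<open>The adjoint of one step. The head position is dropped, because it is the number of steps.\<close>

definition heis :: "('q, 'a, 'r) qfa_ioc \<Rightarrow> 'a tape_sym \<Rightarrow>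
    ('q \<times> nat \<Rightarrow> 'q \<times> nat \<Rightarrow> complex) \<Rightarrow> 'q \<times> nat \<Rightarrow> 'q \<times> nat \<Rightarrow> complex" where
  "heis N \<sigma> X = (\<lambda>(q, v) (p, u). \<Sum>\<omega>\<in>qc_registers N.
     \<Sum>(q', c)\<in>qc_states N \<times> {0, 1}. \<Sum>(p', d)\<in>qc_states N \<times> {0, 1}.
       cnj (qc_delta N q \<sigma> q' c \<omega>) * qc_delta N p \<sigma> p' d \<omega> * X (q', v + c) (p', u + d))"

definition kron :: "'b \<Rightarrow> 'b \<Rightarrow> complex" where
  "kron a b = of_bool (a = b)"

text \<open>The diagonal projection onto accepting states. It leaves the counter free, as only the
  internal state is measured.\<close>

definition acc_obs :: "('q, 'a, 'r) qfa_ioc \<Rightarrow> 'q \<times> nat \<Rightarrow> 'q \<times> nat \<Rightarrow> complex" where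
  "acc_obs N a b = of_bool (a = b \<and> fst a \<in> qc_accept N)"

definition st :: "'q qc_conf \<Rightarrow> 'q \<times> nat" where
  "st = (\<lambda>(q, i, v). (q, v))"

lemma attainable_states:
  assumes "(q, i, v) \<in> qc_attainable N t" "qc_init N \<in> qc_states N"
  shows "q \<in> qc_states N"
  using assms by (induction q i v rule: qc_attainable.induct) auto

text \<open>This trades the input-dependent set of attainable configurations for a fixed product of
  states and increments. Terms in only one of the two index sets vanish: an attainable non-successor
  has matrix entry 0, and a successor outside the attainable set has amplitude 0.\<close>

lemma sum_successors:
  assumes fin: "finite (qc_states N)" and init: "qc_init N \<in> qc_states N"
    and a: "(q, i, v) \<in> qc_attainable N t" and i: "i < length t" and w: "\<omega> \<in> qc_registers N"
  shows "(\<Sum>b\<in>qc_attainable N t. qc_E N t \<omega> b (q, i, v) * g b)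
    = (\<Sum>(q', c)\<in>qc_states N \<times> {0, 1}. qc_delta N q (t ! i) q' c \<omega> * g (q', Suc i, v + c))"
proof -
  let ?C = "qc_attainable N t" and ?S = "qc_states N \<times> {0, 1::nat}"
  define F where "F = (\<lambda>(q'::'a, c::nat). (q', Suc i, v + c))"
  have inj: "inj_on F ?S" by (auto simp: F_def inj_on_def)
  have "(\<Sum>b\<in>?C. qc_E N t \<omega> b (q, i, v) * g b) = (\<Sum>b\<in>F ` ?S. qc_E N t \<omega> b (q, i, v) * g b)"
  proof (rule sum.mono_neutral_cong)
    show "finite ?C" using fin init by (rule finite_qc_attainable)
    show "finite (F ` ?S)" using fin by simp
    show "qc_E N t \<omega> b (q, i, v) * g b = 0" if b: "b \<in> ?C - F ` ?S" for b
    proof -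
      obtain q' i' v' where eq: "b = (q', i', v')" by (cases b)
      have q': "q' \<in> qc_states N" using b eq init attainable_states by auto
      have "\<not> (i' = Suc i \<and> (v' = v \<or> v' = v + 1))"
      proof
        assume h: "i' = Suc i \<and> (v' = v \<or> v' = v + 1)"
        then have "b = F (q', v' - v)" "(q', v' - v) \<in> ?S" using q' by (auto simp: eq F_def)
        then show False using b by blast
      qed
      then show ?thesis by (auto simp: eq qc_E_def)
    qed
    show "qc_E N t \<omega> b (q, i, v) * g b = 0" if b: "b \<in> F ` ?S - ?C" for b
    proof -
      obtain q' c where eq: "b = (q', Suc i, v + c)" and s: "q' \<in> qc_states N" "c \<in> {0, 1}"
        using b by (auto simp: F_def)
      have "qc_delta N q (t ! i) q' c \<omega> = 0"
        using qc_attainable.step[OF a i s w] b eq by auto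
      then show ?thesis by (auto simp: eq qc_E_def)
    qed
  qed simp
  also have "\<dots> = (\<Sum>x\<in>?S. qc_E N t \<omega> (F x) (q, i, v) * g (F x))"
    by (rule sum.reindex[OF inj, unfolded o_def])
  also have "\<dots> = (\<Sum>(q', c)\<in>?S. qc_delta N q (t ! i) q' c \<omega> * g (q', Suc i, v + c))"
    by (rule sum.cong) (auto simp: F_def qc_E_def i)
  finally show ?thesis .
qed

lemma heis_qc_E:
  assumes fin: "finite (qc_states N)" and init: "qc_init N \<in> qc_states N"
    and a: "(q, i, v) \<in> qc_attainable N t" and b: "(p, i, u) \<in> qc_attainable N t"
    and i: "i < length t"
  shows "(\<Sum>\<omega>\<in>qc_registers N. \<Sum>c\<in>qc_attainable N t. \<Sum>d\<in>qc_attainable N t.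
      cnj (qc_E N t \<omega> c (q, i, v)) * qc_E N t \<omega> d (p, i, u) * X (st c) (st d))
    = heis N (t ! i) X (q, v) (p, u)"
proof -
  let ?C = "qc_attainable N t" and ?S = "qc_states N \<times> {0, 1::nat}"
  have "(\<Sum>c\<in>?C. \<Sum>d\<in>?C. cnj (qc_E N t \<omega> c (q, i, v)) * qc_E N t \<omega> d (p, i, u) * X (st c) (st d))
    = (\<Sum>(q', c)\<in>?S. \<Sum>(p', d)\<in>?S. cnj (qc_delta N q (t ! i) q' c \<omega>) *
         qc_delta N p (t ! i) p' d \<omega> * X (q', v + c) (p', u + d))"
    if w: "\<omega> \<in> qc_registers N" for \<omega>
  proof -
    define G where "G c = (\<Sum>d\<in>?C. qc_E N t \<omega> d (p, i, u) * X (st c) (st d))" for c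
    have G: "G c = (\<Sum>(p', d)\<in>?S. qc_delta N p (t ! i) p' d \<omega> * X (st c) (p', u + d))" for c
      unfolding G_def sum_successors[OF fin init b i w, of "\<lambda>d. X (st c) (st d)"]
      by (simp add: st_def)
    \<comment> \<open>Pulling the conjugation outside lets \<open>sum_successors\<close> apply to
      the conjugated factor too.\<close>
    have "(\<Sum>c\<in>?C. \<Sum>d\<in>?C. cnj (qc_E N t \<omega> c (q, i, v)) * qc_E N t \<omega> d (p, i, u) * X (st c) (st d))
      = cnj (\<Sum>c\<in>?C. qc_E N t \<omega> c (q, i, v) * cnj (G c))"
      by (simp add: G_def sum_distrib_left mult.assoc)
    also have "\<dots> = (\<Sum>(q', c)\<in>?S. cnj (qc_delta N q (t ! i) q' c \<omega>) * G (q', Suc i, v + c))"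
      unfolding sum_successors[OF fin init a i w, of "\<lambda>c. cnj (G c)"]
      by (simp add: case_prod_beta')
    also have "\<dots> = (\<Sum>(q', c)\<in>?S. \<Sum>(p', d)\<in>?S. cnj (qc_delta N q (t ! i) q' c \<omega>) *
         qc_delta N p (t ! i) p' d \<omega> * X (q', v + c) (p', u + d))"
      unfolding G by (intro sum.cong refl) (auto simp: st_def sum_distrib_left mult.assoc case_prod_beta')
    finally show ?thesis .
  qed
  then show ?thesis by (simp add: heis_def)
qed

text \<open>Well-formedness says that the adjoint step fixes the identity \<open>kron\<close>.
  Configurations with different head positions have disjoint successors, so a condition per symbol,
  without mention of inputs, suffices.\<close>

lemma well_formed_heisI:
  assumes fin: "finite (qc_states N)" and init: "qc_init N \<in> qc_states N"
    and iso: "\<And>\<sigma> q p v u. \<lbrakk>\<sigma> \<in> tape_syms (qc_alphabet N); q \<in> qc_states N; p \<in> qc_states N\<rbrakk>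
      \<Longrightarrow> heis N \<sigma> kron (q, v) (p, u) = kron (q, v) (p, u)"
  shows "qc_well_formed N"
proof -
  have "(\<Sum>\<omega>\<in>qc_registers N. \<Sum>c\<in>qc_attainable N t. cnj (qc_E N t \<omega> c a) * qc_E N t \<omega> c b)
      = (if a = b then 1 else 0)"
    if w: "w \<in> lists (qc_alphabet N)" and t: "t = tape w"
      and a: "a \<in> qc_attainable N t" "fst (snd a) < length t"
      and b: "b \<in> qc_attainable N t" "fst (snd b) < length t" for w t a b
  proof -
    let ?C = "qc_attainable N t"
    obtain q i v where a': "a = (q, i, v)" by (cases a)
    obtain p j u where b': "b = (p, j, u)" by (cases b)
    show ?thesis
    proof (cases "i = j")
      case False
      then have "cnj (qc_E N t \<omega> c a) * qc_E N t \<omega> c b = 0" for \<omega> c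
        by (cases c) (auto simp: a' b' qc_E_def)
      then have "(\<Sum>\<omega>\<in>qc_registers N. \<Sum>c\<in>?C. cnj (qc_E N t \<omega> c a) * qc_E N t \<omega> c b) = 0"
        by (intro sum.neutral ballI)
      then show ?thesis using False by (simp add: a' b')
    next
      case True
      have sym: "t ! i \<in> tape_syms (qc_alphabet N)"
      proof -
        have "set t \<subseteq> tape_syms (qc_alphabet N)"
          using w by (auto simp: t tape_def tape_syms_def)
        then show ?thesis using a by (auto simp: a' dest: nth_mem)
      qed
      have finC: "finite ?C" using fin init by (rule finite_qc_attainable)
      \<comment> \<open>Both successors have head position \<open>i + 1\<close>, so
        \<open>kron\<close> on state and counter alone already identifies the
        configurations.\<close>
      have *: "cnj (qc_E N t \<omega> c a) * qc_E N t \<omega> c b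
        = (\<Sum>d\<in>?C. cnj (qc_E N t \<omega> c a) * qc_E N t \<omega> d b * kron (st c) (st d))"
        if c: "c \<in> ?C" for \<omega> c
      proof -
        have "cnj (qc_E N t \<omega> c a) * qc_E N t \<omega> d b * kron (st c) (st d)
          = (if d = c then cnj (qc_E N t \<omega> c a) * qc_E N t \<omega> c b else 0)" for d
          using True by (cases c; cases d) (auto simp: a' b' qc_E_def kron_def st_def)
        then show ?thesis using c by (simp add: sum.delta[OF finC])
      qed
      have "(\<Sum>\<omega>\<in>qc_registers N. \<Sum>c\<in>?C. cnj (qc_E N t \<omega> c a) * qc_E N t \<omega> c b)
        = heis N (t ! i) kron (q, v) (p, u)"
        using heis_qc_E[OF fin init, of q i v t p u kron] a b True * by (simp add: a' b')
      also have "\<dots> = kron (q, v) (p, u)"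
        using iso sym attainable_states init a b by (metis a' b')
      finally show ?thesis using True by (simp add: kron_def a' b')
    qed
  qed
  then show ?thesis unfolding qc_well_formed_def Let_def by fastforce
qed

text \<open>This justifies dropping the head position: on the support of the \<open>k\<close>-th
  density matrix, \<open>st\<close> is injective.\<close>

lemma evolve_support:
  assumes "(qc_evolve N t ^^ k) (qc_initial N) a b \<noteq> 0"
  shows "fst (snd a) = k \<and> fst (snd b) = k"
  using assms
proof (induction k arbitrary: a b)
  case 0
  then show ?case by (auto simp: qc_initial_def split: if_splits)
next
  case (Suc k)
  let ?r = "(qc_evolve N t ^^ k) (qc_initial N)"
  have "\<exists>\<omega> c d. qc_E N t \<omega> a c * ?r c d * cnj (qc_E N t \<omega> b d) \<noteq> 0"
  proof (rule ccontr)
    assume "\<not> ?thesis"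
    then have "qc_evolve N t ?r a b = 0"
      unfolding qc_evolve_def by (intro sum.neutral ballI) blast
    then show False using Suc.prems by simp
  qed
  then obtain \<omega> c d where "qc_E N t \<omega> a c \<noteq> 0" "?r c d \<noteq> 0" "qc_E N t \<omega> b d \<noteq> 0" by auto
  with Suc.IH[of c d] show ?case
    by (cases a; cases b; cases c; cases d) (auto simp: qc_E_def split: if_splits)
qed

lemma sum_swap4:
  "(\<Sum>a\<in>A. \<Sum>b\<in>B. \<Sum>\<omega>\<in>W. \<Sum>c\<in>C. \<Sum>d\<in>D. f a b \<omega> c d)
    = (\<Sum>c\<in>C. \<Sum>d\<in>D. \<Sum>\<omega>\<in>W. \<Sum>b\<in>B. \<Sum>a\<in>A. (f a b \<omega> c d :: complex))"
proof -
  have "(\<Sum>a\<in>A. \<Sum>b\<in>B. \<Sum>\<omega>\<in>W. \<Sum>c\<in>C. \<Sum>d\<in>D. f a b \<omega> c d)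
    = (\<Sum>(a, b, \<omega>, c, d)\<in>A \<times> B \<times> W \<times> C \<times> D. f a b \<omega> c d)"
    by (simp add: sum.cartesian_product)
  also have "\<dots> = (\<Sum>(c, d, \<omega>, b, a)\<in>C \<times> D \<times> W \<times> B \<times> A. f a b \<omega> c d)"
    by (rule sum.reindex_bij_witness[where i = "\<lambda>(c, d, \<omega>, b, a). (a, b, \<omega>, c, d)"
          and j = "\<lambda>(a, b, \<omega>, c, d). (c, d, \<omega>, b, a)"]) auto
  finally show ?thesis by (simp add: sum.cartesian_product)
qed

text \<open>The trace of the \<open>k\<close>-th density matrix times the observable pulled back
  through the remaining symbols does not depend on \<open>k\<close>. Each induction step moves one
  evolution step from the state to the observable; at \<open>k = 0\<close> only the initial entry is
  left.\<close>

lemma evolve_duality: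
  assumes fin: "finite (qc_states N)" and init: "qc_init N \<in> qc_states N" and k: "k \<le> length t"
  defines "C \<equiv> qc_attainable N t"
  shows "(\<Sum>a\<in>C. \<Sum>b\<in>C. (qc_evolve N t ^^ k) (qc_initial N) a b *
           foldr (heis N) (drop k t) X (st b) (st a))
    = foldr (heis N) t X (qc_init N, 0) (qc_init N, 0)"
  using k
proof (induction k)
  case 0
  let ?i = "(qc_init N, 0, 0)"
  have finC: "finite C" unfolding C_def using fin init by (rule finite_qc_attainable)
  have iC: "?i \<in> C" unfolding C_def by (rule qc_attainable.init)
  have "(\<Sum>b\<in>C. qc_initial N a b * foldr (heis N) t X (st b) (st a))
    = (if a = ?i then foldr (heis N) t X (st ?i) (st ?i) else 0)" for a
  proof -
    have "qc_initial N a b * foldr (heis N) t X (st b) (st a)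
      = (if b = ?i then (if a = ?i then foldr (heis N) t X (st ?i) (st ?i) else 0) else 0)" for b
      by (auto simp: qc_initial_def)
    then show ?thesis using iC by (simp add: sum.delta[OF finC])
  qed
  then show ?case using iC by (simp add: sum.delta[OF finC] st_def)
next
  case (Suc k)
  let ?r = "(qc_evolve N t ^^ k) (qc_initial N)"
  let ?Y = "foldr (heis N) (drop (Suc k) t) X"
  have dr: "drop k t = t ! k # drop (Suc k) t"
    using Suc.prems by (simp add: Cons_nth_drop_Suc)
  have "(\<Sum>a\<in>C. \<Sum>b\<in>C. (qc_evolve N t ^^ Suc k) (qc_initial N) a b * ?Y (st b) (st a))
    = (\<Sum>a\<in>C. \<Sum>b\<in>C. \<Sum>\<omega>\<in>qc_registers N. \<Sum>c\<in>C. \<Sum>d\<in>C.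
        ?r c d * (cnj (qc_E N t \<omega> b d) * qc_E N t \<omega> a c * ?Y (st b) (st a)))"
    by (simp only: funpow.simps comp_apply qc_evolve_def C_def[symmetric] sum_distrib_right)
       (simp only: ac_simps)
  also have "\<dots> = (\<Sum>c\<in>C. \<Sum>d\<in>C. \<Sum>\<omega>\<in>qc_registers N. \<Sum>b\<in>C. \<Sum>a\<in>C.
        ?r c d * (cnj (qc_E N t \<omega> b d) * qc_E N t \<omega> a c * ?Y (st b) (st a)))"
    by (rule sum_swap4)
  also have "\<dots> = (\<Sum>c\<in>C. \<Sum>d\<in>C. ?r c d * foldr (heis N) (drop k t) X (st d) (st c))"
  proof (intro sum.cong refl)
    fix c d assume c: "c \<in> C" and d: "d \<in> C"
    show "(\<Sum>\<omega>\<in>qc_registers N. \<Sum>b\<in>C. \<Sum>a\<in>C.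
        ?r c d * (cnj (qc_E N t \<omega> b d) * qc_E N t \<omega> a c * ?Y (st b) (st a)))
      = ?r c d * foldr (heis N) (drop k t) X (st d) (st c)"
    proof (cases "?r c d = 0")
      case False
      \<comment> \<open>\<open>heis_qc_E\<close> requires both configurations to have the same head
        position, which holds wherever the density matrix is nonzero.\<close>
      then have "fst (snd c) = k" "fst (snd d) = k" using evolve_support by blast+
      then obtain q v p u where eq: "c = (q, k, v)" "d = (p, k, u)"
        by (cases c; cases d) auto
      have kl: "k < length t" using Suc.prems by simp
      from heis_qc_E[OF fin init _ _ kl, of p u q v ?Y] c d show ?thesis
        by (simp add: sum_distrib_left[symmetric] C_def eq dr st_def)
    qed simp
  qed
  also have "\<dots> = foldr (heis N) t X (qc_init N, 0) (qc_init N, 0)"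
    using Suc by simp
  finally show ?case .
qed

lemma qc_prob_heis:
  assumes fin: "finite (qc_states N)" and init: "qc_init N \<in> qc_states N"
  shows "qc_prob N w = Re (foldr (heis N) (tape w) (acc_obs N) (qc_init N, 0) (qc_init N, 0))"
proof -
  let ?t = "tape w"
  let ?C = "qc_attainable N ?t"
  let ?r = "(qc_evolve N ?t ^^ length ?t) (qc_initial N)"
  have finC: "finite ?C" using fin init by (rule finite_qc_attainable)
  have row: "(\<Sum>b\<in>?C. ?r a b * acc_obs N (st b) (st a)) = (if fst a \<in> qc_accept N then ?r a a else 0)"
    if a: "a \<in> ?C" for a
  proof -
    have "?r a b * acc_obs N (st b) (st a)
      = (if b = a then (if fst a \<in> qc_accept N then ?r a a else 0) else 0)" for b
    proof (cases "?r a b = 0")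
      case False
      then have "fst (snd a) = fst (snd b)" using evolve_support by metis
      then show ?thesis by (cases a; cases b) (auto simp: st_def acc_obs_def)
    qed auto
    then show ?thesis using a by (simp add: sum.delta[OF finC])
  qed
  have "foldr (heis N) ?t (acc_obs N) (qc_init N, 0) (qc_init N, 0)
    = (\<Sum>a\<in>?C. \<Sum>b\<in>?C. ?r a b * acc_obs N (st b) (st a))"
    using evolve_duality[OF fin init order_refl, of ?t "acc_obs N"] by simp
  also have "\<dots> = (\<Sum>a\<in>?C. if fst a \<in> qc_accept N then ?r a a else 0)"
    using row by simp
  also have "\<dots> = (\<Sum>a\<in>{(q, i, v) \<in> ?C. q \<in> qc_accept N}. ?r a a)"
    using finC by (simp add: sum.inter_filter[symmetric] case_prod_beta')
  finally show ?thesis by (simp add: qc_prob_def Let_def)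
qed

text \<open>The theorem asks for natural numbers as states and register symbols. An injective
  renaming respects \<open>kron\<close> and \<open>acc_obs\<close>, and \<open>heis\<close>
  preserves this, so well-formedness and probabilities transfer through the dual
  description.\<close>

lemma nat_machine:
  fixes N :: "('s, 'a, 'r) qfa_ioc"
  assumes fin: "finite (qc_states N)" "finite (qc_registers N)" "finite (qc_alphabet N)"
    and init: "qc_init N \<in> qc_states N" and acc: "qc_accept N \<subseteq> qc_states N"
    and iso: "\<And>\<sigma> q p v u. \<lbrakk>\<sigma> \<in> tape_syms (qc_alphabet N); q \<in> qc_states N; p \<in> qc_states N\<rbrakk>
      \<Longrightarrow> heis N \<sigma> kron (q, v) (p, u) = kron (q, v) (p, u)"
  obtains N' :: "(nat, 'a, nat) qfa_ioc" where "rt_qfa_ioc N'" "qc_alphabet N' = qc_alphabet N"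
    "\<And>w. qc_prob N' w = qc_prob N w"
proof -
  let ?S = "qc_states N" and ?R = "qc_registers N"
  obtain f :: "'s \<Rightarrow> nat" where f: "inj_on f ?S"
    using finite_imp_inj_to_nat_seg[OF fin(1)] by blast
  obtain g :: "'r \<Rightarrow> nat" where g: "inj_on g ?R"
    using finite_imp_inj_to_nat_seg[OF fin(2)] by blast
  define N' :: "(nat, 'a, nat) qfa_ioc" where "N' = \<lparr>qc_states = f ` ?S, qc_alphabet = qc_alphabet N,
    qc_registers = g ` ?R,
    qc_delta = \<lambda>n \<sigma> m c \<omega>. qc_delta N (inv_into ?S f n) \<sigma> (inv_into ?S f m) c (inv_into ?R g \<omega>),
    qc_init = f (qc_init N), qc_accept = f ` qc_accept N\<rparr>"
  have N'_simps [simp]: "qc_states N' = f ` ?S" "qc_alphabet N' = qc_alphabet N" "qc_registers N' = g ` ?R"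
    "qc_init N' = f (qc_init N)" "qc_accept N' = f ` qc_accept N"
    by (simp_all add: N'_def)
  have delta: "qc_delta N' (f q) \<sigma> (f p) c (g \<omega>) = qc_delta N q \<sigma> p c \<omega>"
    if "q \<in> ?S" "p \<in> ?S" "\<omega> \<in> ?R" for q \<sigma> p c \<omega>
    using that f g by (simp add: N'_def)
  \<comment> \<open>Only entries at genuine states are compared: there \<open>inv_into\<close>
    undoes the renaming, and \<open>heis\<close> reads no others.\<close>
  define agree where "agree X X' \<longleftrightarrow>
      (\<forall>q\<in>?S. \<forall>p\<in>?S. \<forall>v u. X' (f q, v) (f p, u) = X (q, v) (p, u))"
    for X :: "'s \<times> nat \<Rightarrow> 's \<times> nat \<Rightarrow> complex" and X' :: "nat \<times> nat \<Rightarrow> nat \<times> nat \<Rightarrow> complex"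
  have reindex: "(\<Sum>(n, c)\<in>f ` ?S \<times> {0, 1::nat}. h n c) = (\<Sum>(q, c)\<in>?S \<times> {0, 1::nat}. h (f q) c)"
    for h :: "nat \<Rightarrow> nat \<Rightarrow> complex"
    by (simp add: sum.cartesian_product[symmetric] sum.reindex[OF f])
  have heis: "agree (heis N \<sigma> X) (heis N' \<sigma> X')" if X: "agree X X'" for X X' \<sigma>
    unfolding agree_def heis_def prod.case N'_simps reindex sum.reindex[OF g] o_def
    by (intro ballI allI sum.cong refl) (auto simp: delta X[unfolded agree_def] intro!: sum.cong)
  have fold: "agree (foldr (heis N) ts X) (foldr (heis N') ts X')" if "agree X X'" for X X' ts
    using that by (induction ts) (auto intro: heis)
  have kron: "agree kron kron"
    using f by (auto simp: agree_def kron_def inj_on_eq_iff)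
  have obs: "agree (acc_obs N) (acc_obs N')"
    using f acc by (auto simp: agree_def acc_obs_def inj_on_eq_iff inj_on_image_mem_iff)
  have "qc_well_formed N'"
  proof (rule well_formed_heisI)
    fix \<sigma> q p and v u :: nat
    assume "\<sigma> \<in> tape_syms (qc_alphabet N')" "q \<in> qc_states N'" "p \<in> qc_states N'"
    then show "heis N' \<sigma> kron (q, v) (p, u) = kron (q, v) (p, u)"
      using heis[OF kron, of \<sigma>] kron iso by (auto simp: agree_def)
  qed (use fin init in auto)
  then have "rt_qfa_ioc N'"
    using fin init acc by (auto simp: rt_qfa_ioc_def)
  moreover have "qc_prob N' w = qc_prob N w" for w
    using fold[OF obs, of "tape w"] fin init by (simp add: qc_prob_heis agree_def)
  ultimately show ?thesis using that[of N'] by simp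
qed


section \<open>The simulating machine\<close>

text \<open>\<open>Zero\<close>: the counter has never been nonzero. \<open>Pending b\<close>: the counter is assumed not to have
  returned to zero; the path \<open>True\<close> counts increments, the path \<open>False\<close> decrements. \<open>Resolved s \<theta>\<close>: the
  counter is assumed to have returned to zero and to have status \<open>\<theta>\<close> now; the branch \<open>s = False\<close>
  inverts the answer.\<close>

datatype 'q sim = Zero 'q | Pending bool 'q | Resolved bool bool 'q

definition rt2 :: complex where "rt2 = complex_of_real (1 / sqrt 2)"
definition rt3 :: complex where "rt3 = complex_of_real (1 / sqrt 3)"

lemma rt2 [simp]: "cnj rt2 = rt2" "rt2 * rt2 = 1 / 2" "rt2 * (rt2 * z) = z / 2"
proof -
  show "rt2 * rt2 = 1 / 2"
    unfolding rt2_def of_real_mult[symmetric] by simp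
  then show "rt2 * (rt2 * z) = z / 2" by (simp add: mult.assoc[symmetric])
qed (auto simp: rt2_def)

lemma rt3 [simp]: "cnj rt3 = rt3" "rt3 * rt3 = 1 / 3" "rt3 * (rt3 * z) = z / 3"
proof -
  show "rt3 * rt3 = 1 / 3"
    unfolding rt3_def of_real_mult[symmetric] by simp
  then show "rt3 * (rt3 * z) = z / 3" by (simp add: mult.assoc[symmetric])
qed (auto simp: rt3_def)

text \<open>\<open>Resolved\<close> no longer increments the quantum counter, so the two counts stay
  frozen as they were at the guess and interfere later exactly if they agreed then. Its status
  starts as \<open>False\<close> because the simulated counter is assumed to be zero at that
  moment.\<close>

fun sim_moves :: "('q, 'a) d1ca \<Rightarrow> 'a tape_sym \<Rightarrow> 'q sim \<Rightarrow> (('q sim \<times> nat) \<times> complex) list" where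
  "sim_moves M \<sigma> (Zero q) =
     (let q' = dc_delta M q \<sigma> False; d = dc_update M q'
      in if d = 0 then [((Zero q', 0), 1)]
         else [((Pending True q', of_bool (d = 1)), rt2), ((Pending False q', of_bool (d = -1)), rt2)])"
| "sim_moves M \<sigma> (Pending b q) =
     (let q' = dc_delta M q \<sigma> True; c = of_bool (dc_update M q' = (if b then 1 else -1))
      in [((Pending b q', c), rt3), ((Resolved True False q', c), rt3),
          ((Resolved False False q', c), if b then rt3 else - rt3)])"
| "sim_moves M \<sigma> (Resolved s \<theta> q) =
     (let q' = dc_delta M q \<sigma> \<theta>
      in [((Resolved s (\<theta> \<or> dc_update M q' \<noteq> 0) q', 0), 1)])"

text \<open>The symbol written in the register records the source state up to the path, so that only the
  two pending paths interfere.\<close>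

fun sim_key :: "'q sim \<Rightarrow> 'q sim" where
  "sim_key (Pending b q) = Pending True q"
| "sim_key s = s"

text \<open>The deterministic run with the counter reduced to its status bit. Once true the bit
  stays true, which is faithful as long as the counter does not return to zero again.\<close>

fun guess_accepts :: "('q, 'a) d1ca \<Rightarrow> bool \<Rightarrow> 'q \<Rightarrow> 'a tape_sym list \<Rightarrow> bool" where
  "guess_accepts M \<theta> q [] \<longleftrightarrow> q \<in> dc_accept M"
| "guess_accepts M \<theta> q (\<sigma> # ts) \<longleftrightarrow>
     (let q' = dc_delta M q \<sigma> \<theta> in guess_accepts M (\<theta> \<or> dc_update M q' \<noteq> 0) q' ts)"

definition sg :: "bool \<Rightarrow> real" where
  "sg b = (if b then 1 else -1)"

text \<open>The excess over \<open>1 / 2\<close> of the acceptance probability when the two pending paths, each of weight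
  \<open>1 / 2\<close>, are in state \<open>q\<close> with counts that differ by \<open>u\<close>.\<close>

fun bias :: "('q, 'a) d1ca \<Rightarrow> 'q \<Rightarrow> int \<Rightarrow> 'a tape_sym list \<Rightarrow> real" where
  "bias M q u [] = sg (q \<in> dc_accept M) / 2"
| "bias M q u (\<sigma> # ts) =
     (let q' = dc_delta M q \<sigma> True; u' = u + dc_update M q'
      in (bias M q' u' ts + of_bool (u' = 0) * sg (guess_accepts M False q' ts)) / 3)"

definition sim_states :: "('q, 'a) d1ca \<Rightarrow> 'q sim set" where
  "sim_states M = Zero ` dc_states M \<union> (\<Union>b. Pending b ` dc_states M) \<union>
     (\<Union>s \<theta>. Resolved s \<theta> ` dc_states M)"

definition sim_accept :: "('q, 'a) d1ca \<Rightarrow> 'q sim set" where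
  "sim_accept M = Zero ` dc_accept M \<union> (\<Union>b. Pending b ` dc_accept M) \<union>
     (\<Union>\<theta>. Resolved True \<theta> ` dc_accept M) \<union>
     (\<Union>\<theta>. Resolved False \<theta> ` (dc_states M - dc_accept M))"

definition sim_qfa :: "('q, 'a) d1ca \<Rightarrow> ('q sim, 'a, 'q sim) qfa_ioc" where
  "sim_qfa M = \<lparr>qc_states = sim_states M, qc_alphabet = dc_alphabet M,
     qc_registers = sim_states M,
     qc_delta = \<lambda>s \<sigma> s' c \<omega>. if \<omega> = sim_key s
       then (\<Sum>(y, x)\<leftarrow>sim_moves M \<sigma> s. x * of_bool (y = (s', c))) else 0,
     qc_init = Zero (dc_init M), qc_accept = sim_accept M\<rparr>"

lemma sim_qfa_simps [simp]:
  "qc_states (sim_qfa M) = sim_states M" "qc_alphabet (sim_qfa M) = dc_alphabet M"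
  "qc_registers (sim_qfa M) = sim_states M" "qc_init (sim_qfa M) = Zero (dc_init M)"
  "qc_accept (sim_qfa M) = sim_accept M"
  by (simp_all add: sim_qfa_def)

lemma sim_states_simps [simp]:
  "Zero q \<in> sim_states M \<longleftrightarrow> q \<in> dc_states M"
  "Pending b q \<in> sim_states M \<longleftrightarrow> q \<in> dc_states M"
  "Resolved s \<theta> q \<in> sim_states M \<longleftrightarrow> q \<in> dc_states M"
  by (auto simp: sim_states_def image_iff)

lemma sim_accept_simps [simp]:
  "Zero q \<in> sim_accept M \<longleftrightarrow> q \<in> dc_accept M"
  "Pending b q \<in> sim_accept M \<longleftrightarrow> q \<in> dc_accept M"
  "Resolved s \<theta> q \<in> sim_accept M \<longleftrightarrow> (if s then q \<in> dc_accept M else q \<in> dc_states M - dc_accept M)"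
  by (auto simp: sim_accept_def image_iff)

section \<open>Adjoint steps of the simulating machine\<close>

lemma sum_moves:
  fixes l :: "('b \<times> complex) list"
  assumes "finite S" "fst ` set l \<subseteq> S"
  shows "(\<Sum>y\<in>S. (\<Sum>(y', x)\<leftarrow>l. x * of_bool (y' = y)) * g y) = (\<Sum>(y, x)\<leftarrow>l. x * g y)"
  using assms(2)
proof (induction l)
  case (Cons p l)
  obtain y' x where p: "p = (y', x)" by (cases p)
  have "(\<Sum>y\<in>S. x * of_bool (y' = y) * g y) = x * g y'"
  proof -
    have "x * of_bool (y' = y) * g y = (if y = y' then x * g y' else 0)" for y by simp
    then show ?thesis using Cons.prems by (simp add: p sum.delta[OF assms(1)])
  qed
  then show ?case using Cons by (simp add: p distrib_right sum.distrib)
qed simp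

context
  fixes M :: "('q, 'a) d1ca"
  assumes M: "rt_d1ca M"
begin

lemma delta_states: "\<lbrakk>q \<in> dc_states M; \<sigma> \<in> tape_syms (dc_alphabet M)\<rbrakk> \<Longrightarrow> dc_delta M q \<sigma> \<theta> \<in> dc_states M"
  using M by (auto simp: rt_d1ca_def)

lemma update_cases: "q \<in> dc_states M \<Longrightarrow> dc_update M q = -1 \<or> dc_update M q = 0 \<or> dc_update M q = 1"
  using M by (auto simp: rt_d1ca_def)

lemma finite_sim_states: "finite (sim_states M)"
  using M by (auto simp: sim_states_def rt_d1ca_def)

lemma sim_key_states: "s \<in> sim_states M \<Longrightarrow> sim_key s \<in> sim_states M"
  by (cases s) auto

lemma sim_moves_states:
  assumes "s \<in> sim_states M" "\<sigma> \<in> tape_syms (dc_alphabet M)"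
  shows "fst ` set (sim_moves M \<sigma> s) \<subseteq> sim_states M \<times> {0, 1}"
  using assms by (cases s) (auto simp: Let_def delta_states)

text \<open>The source state determines the register symbol, so the sum over the register collapses
  to the test whether both sources write the same one.\<close>

lemma heis_sim:
  assumes "\<sigma> \<in> tape_syms (dc_alphabet M)" "s \<in> sim_states M" "s' \<in> sim_states M"
  shows "heis (sim_qfa M) \<sigma> X (s, v) (s', u) = (if sim_key s = sim_key s'
    then (\<Sum>((r, c), x)\<leftarrow>sim_moves M \<sigma> s. \<Sum>((r', c'), x')\<leftarrow>sim_moves M \<sigma> s'.
       cnj x * x' * X (r, v + c) (r', u + c')) else 0)"
proof -
  let ?S = "sim_states M \<times> {0, 1::nat}"
  let ?l = "sim_moves M \<sigma> s" and ?l' = "sim_moves M \<sigma> s'"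
  have fin: "finite ?S" using finite_sim_states by simp
  have inner: "(\<Sum>y'\<in>?S. (\<Sum>(z, x)\<leftarrow>?l'. x * of_bool (z = y')) * h y')
      = (\<Sum>(y', x')\<leftarrow>?l'. x' * h y')" for h
    by (rule sum_moves[OF fin sim_moves_states[OF assms(3,1)]])
  have outer: "(\<Sum>y\<in>?S. cnj (\<Sum>(z, x)\<leftarrow>?l. x * of_bool (z = y)) * h y)
      = (\<Sum>(y, x)\<leftarrow>?l. cnj x * h y)" for h
  proof -
    have "(\<Sum>y\<in>?S. (\<Sum>(z, x)\<leftarrow>?l. x * of_bool (z = y)) * cnj (h y)) = (\<Sum>(y, x)\<leftarrow>?l. x * cnj (h y))"
      by (rule sum_moves[OF fin sim_moves_states[OF assms(2,1)]])
    then have "cnj (\<Sum>y\<in>?S. (\<Sum>(z, x)\<leftarrow>?l. x * of_bool (z = y)) * cnj (h y))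
      = cnj (\<Sum>(y, x)\<leftarrow>?l. x * cnj (h y))" by simp
    moreover have "cnj (sum_list (map f xs)) = sum_list (map (\<lambda>x. cnj (f x)) xs)"
      for f :: "('q sim \<times> nat) \<times> complex \<Rightarrow> complex" and xs
      by (induction xs) auto
    ultimately show ?thesis by (simp add: case_prod_beta')
  qed
  have "heis (sim_qfa M) \<sigma> X (s, v) (s', u) = (\<Sum>\<omega>\<in>sim_states M. if \<omega> = sim_key s then
      (if sim_key s = sim_key s' then \<Sum>y\<in>?S. \<Sum>y'\<in>?S.
         cnj (\<Sum>(z, x)\<leftarrow>?l. x * of_bool (z = y)) * (\<Sum>(z, x)\<leftarrow>?l'. x * of_bool (z = y')) *
         X (fst y, v + snd y) (fst y', u + snd y') else 0) else 0)"
    unfolding heis_def prod.case sim_qfa_simps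
    by (intro sum.cong refl) (auto simp: sim_qfa_def case_prod_beta' intro!: sum.neutral)
  also have "\<dots> = (if sim_key s = sim_key s' then \<Sum>y\<in>?S. \<Sum>y'\<in>?S.
         cnj (\<Sum>(z, x)\<leftarrow>?l. x * of_bool (z = y)) * (\<Sum>(z, x)\<leftarrow>?l'. x * of_bool (z = y')) *
         X (fst y, v + snd y) (fst y', u + snd y') else 0)"
    using sim_key_states[OF assms(2)] by (simp add: sum.delta[OF finite_sim_states])
  also have "(\<Sum>y\<in>?S. \<Sum>y'\<in>?S.
         cnj (\<Sum>(z, x)\<leftarrow>?l. x * of_bool (z = y)) * (\<Sum>(z, x)\<leftarrow>?l'. x * of_bool (z = y')) *
         X (fst y, v + snd y) (fst y', u + snd y'))
    = (\<Sum>(y, x)\<leftarrow>?l. cnj x * (\<Sum>(y', x')\<leftarrow>?l'. x' * X (fst y, v + snd y) (fst y', u + snd y')))"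
    unfolding mult.assoc sum_distrib_left[symmetric] inner outer ..
  finally show ?thesis
    by (simp add: sum_list_const_mult[symmetric] case_prod_beta' mult.assoc)
qed

text \<open>The squared amplitudes of every state add up to 1. Of distinct states only the two
  pending paths over one \<open>q\<close> share a key; if their successors meet, the overlaps in the
  two \<open>Resolved\<close> branches are 1/3 and -1/3 and cancel.\<close>

lemma heis_sim_kron:
  assumes "\<sigma> \<in> tape_syms (dc_alphabet M)" "s \<in> sim_states M" "s' \<in> sim_states M"
  shows "heis (sim_qfa M) \<sigma> kron (s, v) (s', u) = kron (s, v) (s', u)"
  using assms
  by (cases s; cases s') (auto simp: heis_sim kron_def Let_def delta_states)

abbreviation (input) observed where
  "observed ts \<equiv> foldr (heis (sim_qfa M)) ts (acc_obs (sim_qfa M))"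

lemma observed_keys:
  assumes "set ts \<subseteq> tape_syms (dc_alphabet M)" "s \<in> sim_states M" "s' \<in> sim_states M"
    and "sim_key s \<noteq> sim_key s'"
  shows "observed ts (s, v) (s', u) = 0"
  using assms by (cases ts) (auto simp: acc_obs_def heis_sim)

text \<open>The branch runs deterministically with a frozen counter, so different counts stay
  orthogonal. Acceptance is inverted for \<open>s = False\<close>, so exactly one of the two
  branches accepts.\<close>

lemma observed_Resolved:
  assumes "set ts \<subseteq> tape_syms (dc_alphabet M)" "q \<in> dc_states M"
  shows "observed ts (Resolved s \<theta> q, v) (Resolved s \<theta> q, u)
    = of_bool (v = u \<and> s = guess_accepts M \<theta> q ts)"
  using assms
  by (induction ts arbitrary: \<theta> q) (auto simp: acc_obs_def heis_sim Let_def delta_states)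

text \<open>The four entries describe the unnormalised sum of the two paths, of total weight 2. In a
  step the pending part contributes a third of its later value. Equal counts add up to weight 4/3 on
  the answer branch and 0 on the opposite one; different counts give 2/3 on each, of which exactly
  one accepts. This is the recursion of \<open>bias\<close>.\<close>

lemma observed_Pending:
  assumes "set ts \<subseteq> tape_syms (dc_alphabet M)" "q \<in> dc_states M"
  shows "(\<Sum>(b, b')\<in>UNIV \<times> UNIV. observed ts
      (Pending b q, if b then v else u) (Pending b' q, if b' then v else u))
    = 1 + 2 * complex_of_real (bias M q (int v - int u) ts)"
  using assms
proof (induction ts arbitrary: q v u)
  case Nil
  then show ?case by (auto simp: UNIV_bool acc_obs_def sg_def)
next
  case (Cons \<sigma> ts)
  define q' where "q' = dc_delta M q \<sigma> True"
  define d where "d = dc_update M q'"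
  have q': "q' \<in> dc_states M" using Cons.prems delta_states by (auto simp: q'_def)
  have d: "d = -1 \<or> d = 0 \<or> d = 1" using update_cases[OF q'] by (simp add: d_def)
  define v' where "v' = v + of_bool (d = 1)"
  define u' where "u' = u + of_bool (d = -1)"
  \<comment> \<open>One path counts the ups and the other the downs, so the difference of the counts
    follows the simulated counter.\<close>
  have diff: "int v' - int u' = int v - int u + d" using d by (auto simp: v'_def u'_def)
  have eq: "v' = u' \<longleftrightarrow> int v - int u + d = 0" "u' = v' \<longleftrightarrow> int v - int u + d = 0"
    using diff by linarith+
  have ts: "set ts \<subseteq> tape_syms (dc_alphabet M)" using Cons.prems by simp
  note IH = Cons.IH[OF ts q', of v' u', unfolded diff]
  \<comment> \<open>The induction hypothesis is solved for one of its four entries, so that it can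
    serve as a rewrite rule.\<close>
  have IH': "observed ts (Pending False q', u') (Pending False q', u') = 1 + 2 * complex_of_real (bias M q' (int v - int u + d) ts)
      - observed ts (Pending False q', u') (Pending True q', v')
      - observed ts (Pending True q', v') (Pending False q', u')
      - observed ts (Pending True q', v') (Pending True q', v')"
    using IH by (simp add: UNIV_bool algebra_simps)
  note zero = observed_keys[OF ts]
  note res = observed_Resolved[OF ts q']
  show ?case
    using Cons.prems q'
    by (cases "int v - int u + d = 0"; cases "guess_accepts M False q' ts")
      (simp_all add: UNIV_bool heis_sim Let_def q'_def[symmetric] d_def[symmetric]
        v'_def[symmetric] u'_def[symmetric] zero res eq sg_def IH' field_simps)
qed

text \<open>A split gives each pending path weight 1/2, so half of the sum in
  \<open>observed_Pending\<close> appears. The counts already differ by the update that caused the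
  split.\<close>

lemma observed_Zero:
  assumes "set (\<sigma> # ts) \<subseteq> tape_syms (dc_alphabet M)" "q \<in> dc_states M"
  defines "q' \<equiv> dc_delta M q \<sigma> False"
  shows "observed (\<sigma> # ts) (Zero q, v) (Zero q, v)
    = (if dc_update M q' = 0 then observed ts (Zero q', v) (Zero q', v)
       else 1 / 2 + complex_of_real (bias M q' (dc_update M q') ts))"
proof -
  define d where "d = dc_update M q'"
  have q': "q' \<in> dc_states M" using assms delta_states by auto
  have d: "d = -1 \<or> d = 0 \<or> d = 1" using update_cases[OF q'] by (simp add: d_def)
  define v' where "v' = v + of_bool (d = 1)"
  define u' where "u' = v + of_bool (d = -1)"
  have diff: "int v' - int u' = d" using d by (auto simp: v'_def u'_def)
  have ts: "set ts \<subseteq> tape_syms (dc_alphabet M)" using assms by simp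
  note IH = observed_Pending[OF ts q', of v' u', unfolded diff]
  have IH': "observed ts (Pending False q', u') (Pending False q', u') = 1 + 2 * complex_of_real (bias M q' (d) ts)
      - observed ts (Pending False q', u') (Pending True q', v')
      - observed ts (Pending True q', v') (Pending False q', u')
      - observed ts (Pending True q', v') (Pending True q', v')"
    using IH by (simp add: UNIV_bool algebra_simps)
  show ?thesis
    using assms(1,2) q'
    by (simp add: UNIV_bool heis_sim Let_def q'_def[symmetric] d_def[symmetric]
        v'_def[symmetric] u'_def[symmetric] IH' field_simps)
qed

end

text \<open>The bound 1/2 reproduces itself, since (1/2 + 1) / 3 = 1/2. It lies below 1, so a
  correct guess outweighs all later terms.\<close>

lemma abs_bias_le: "\<bar>bias M q u ts\<bar> \<le> 1 / 2"
proof (induction ts arbitrary: q u)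
  case (Cons \<sigma> ts)
  let ?q = "dc_delta M q \<sigma> True"
  from Cons.IH[of ?q "u + dc_update M ?q"] show ?case
    by (auto simp: Let_def sg_def abs_if split: if_splits)
qed (simp add: sg_def)

section \<open>One reversal\<close>

definition sign_changes :: "int list \<Rightarrow> nat" where
  "sign_changes xs = card {i. Suc i < length xs \<and> sgn (xs ! i) \<noteq> sgn (xs ! Suc i)}"

lemma sign_changes_Cons_Cons:
  "sign_changes (x # y # ys) = of_bool (sgn x \<noteq> sgn y) + sign_changes (y # ys)"
proof -
  let ?D = "\<lambda>xs :: int list. {i. Suc i < length xs \<and> sgn (xs ! i) \<noteq> sgn (xs ! Suc i)}"
  have fin: "finite (?D (y # ys))" by (rule finite_subset[of _ "{..length ys}"]) auto
  have "?D (x # y # ys) = {i. i = 0 \<and> sgn x \<noteq> sgn y} \<union> Suc ` ?D (y # ys)"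
  proof (rule set_eqI)
    show "i \<in> ?D (x # y # ys) \<longleftrightarrow> i \<in> {i. i = 0 \<and> sgn x \<noteq> sgn y} \<union> Suc ` ?D (y # ys)" for i
      by (cases i) auto
  qed
  also have "card \<dots> = card {i::nat. i = 0 \<and> sgn x \<noteq> sgn y} + card (?D (y # ys))"
    using fin by (subst card_Un_disjoint) (auto simp: card_image)
  also have "card {i::nat. i = 0 \<and> sgn x \<noteq> sgn y} = of_bool (sgn x \<noteq> sgn y)" by auto
  finally show ?thesis by (simp add: sign_changes_def)
qed

lemma sign_changes_0: "sign_changes (y # ys) = 0 \<Longrightarrow> x \<in> set (y # ys) \<Longrightarrow> sgn x = sgn y"
proof (induction ys arbitrary: y)
  case (Cons z zs)
  then have "sgn y = sgn z" "sign_changes (z # zs) = 0"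
    by (simp_all add: sign_changes_Cons_Cons)
  then show ?case using Cons.IH[of z] Cons.prems(2) by (cases "x = y") simp_all
qed simp

text \<open>The first change uses up the budget, so the rest has constant sign by
  \<open>sign_changes_0\<close>. As no entry is zero, that sign is the opposite one.\<close>

lemma sign_changes_1:
  assumes "sign_changes (y # ys) \<le> 1" "0 \<notin> set (y # ys)"
  shows "\<exists>as bs. y # ys = as @ bs \<and> (\<forall>x\<in>set as. sgn x = sgn y) \<and> (\<forall>x\<in>set bs. sgn x = - sgn y)"
  using assms
proof (induction ys arbitrary: y)
  case Nil
  then show ?case by (intro exI[of _ "[y]"] exI[of _ "[]"]) simp
next
  case (Cons z zs)
  show ?case
  proof (cases "sgn y = sgn z")
    case True
    then have "sign_changes (z # zs) \<le> 1" "0 \<notin> set (z # zs)"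
      using Cons.prems by (simp_all add: sign_changes_Cons_Cons)
    from Cons.IH[OF this] obtain as bs where "z # zs = as @ bs"
      "\<forall>x\<in>set as. sgn x = sgn z" "\<forall>x\<in>set bs. sgn x = - sgn z" by blast
    then show ?thesis using True by (intro exI[of _ "y # as"] exI[of _ bs]) simp
  next
    case False
    then have "sign_changes (z # zs) = 0" using Cons.prems by (simp add: sign_changes_Cons_Cons)
    then have "sgn x = sgn z" if "x \<in> set (z # zs)" for x using that by (rule sign_changes_0)
    moreover have "sgn z = - sgn y"
    proof -
      have "y \<noteq> 0" "z \<noteq> 0" using Cons.prems by auto
      then show ?thesis using False by (simp add: sgn_if split: if_splits)
    qed
    ultimately have "\<forall>x\<in>set (z # zs). sgn x = - sgn y" by metis
    then show ?thesis by (intro exI[of _ "[y]"] exI[of _ "z # zs"]) simp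
  qed
qed

lemma filter_eq_appendE:
  assumes "filter P ds = as @ bs"
  obtains us vs where "ds = us @ vs" "filter P us = as" "filter P vs = bs"
proof -
  have "\<exists>us vs. ds = us @ vs \<and> filter P us = as \<and> filter P vs = bs"
    using assms
  proof (induction ds arbitrary: as)
    case (Cons d ds)
    show ?case
    proof (cases "P d \<and> as \<noteq> []")
      case True
      then obtain as' where "as = d # as'" "filter P ds = as' @ bs"
        using Cons.prems by (cases as) auto
      moreover then obtain us vs where "ds = us @ vs" "filter P us = as'" "filter P vs = bs"
        using Cons.IH by blast
      ultimately show ?thesis using True by (intro exI[of _ "d # us"] exI[of _ vs]) simp
    next
      case False
      then show ?thesis
      proof (cases "as = []")
        case True
        then show ?thesis using Cons.prems by (intro exI[of _ "[]"] exI[of _ "d # ds"]) simp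
      next
        case as: False
        then obtain us vs where "ds = us @ vs" "filter P us = as" "filter P vs = bs"
          using Cons False by auto
        then show ?thesis using as False by (intro exI[of _ "d # us"] exI[of _ vs]) simp
      qed
    qed
  qed simp
  then show ?thesis using that by blast
qed

text \<open>Extracts a turning point \<open>k\<close> and a direction \<open>s\<close>, which treats
  rise-then-fall and fall-then-rise alike. The split of the nonzero entries is pulled back to the
  full list.\<close>

lemma alternations_le_1:
  assumes "alternations ds \<le> 1"
  obtains s k where "s = 1 \<or> s = -1" "\<And>i. \<lbrakk>i < length ds; i < k\<rbrakk> \<Longrightarrow> 0 \<le> s * ds ! i"
    "\<And>i. \<lbrakk>i < length ds; k \<le> i\<rbrakk> \<Longrightarrow> s * ds ! i \<le> 0"
proof -
  let ?xs = "filter (\<lambda>d. d \<noteq> 0) ds"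
  have sc: "sign_changes ?xs \<le> 1" using assms by (simp add: alternations_def sign_changes_def Let_def)
  have "\<exists>s as bs. (s = 1 \<or> s = -1) \<and> ?xs = as @ bs \<and> (\<forall>x\<in>set as. sgn x = s) \<and> (\<forall>x\<in>set bs. sgn x = - s)"
  proof (cases ?xs)
    case Nil
    then show ?thesis by (intro exI[of _ 1] exI[of _ "[]"]) simp
  next
    case (Cons y ys)
    then have nz: "0 \<notin> set (y # ys)" using filter_set[of "\<lambda>d. d \<noteq> 0" ds] by auto
    then have "sgn y = 1 \<or> sgn y = -1" by (auto simp: sgn_if)
    moreover obtain as bs where "y # ys = as @ bs" "\<forall>x\<in>set as. sgn x = sgn y" "\<forall>x\<in>set bs. sgn x = - sgn y"
      using sign_changes_1[OF _ nz] sc Cons by auto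
    ultimately show ?thesis
      unfolding Cons by (intro exI[of _ "sgn y"] exI[of _ as] exI[of _ bs]) simp
  qed
  then obtain s as bs where s: "s = 1 \<or> s = -1" and xs: "?xs = as @ bs"
    and as: "\<forall>x\<in>set as. sgn x = s" and bs: "\<forall>x\<in>set bs. sgn x = - s" by blast
  from xs obtain us vs where ds: "ds = us @ vs" and us: "filter (\<lambda>d. d \<noteq> 0) us = as"
    and vs: "filter (\<lambda>d. d \<noteq> 0) vs = bs"
    by (rule filter_eq_appendE)
  have *: "sgn x = s \<Longrightarrow> 0 \<le> s * x" "sgn x = - s \<Longrightarrow> s * x \<le> 0" for x
    using s by (auto simp: sgn_if split: if_splits)
  have us': "0 \<le> s * x" if "x \<in> set us" for x
  proof (cases "x = 0")
    case False
    then have "x \<in> set as" using that us by auto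
    then show ?thesis using as * by blast
  qed simp
  have vs': "s * x \<le> 0" if "x \<in> set vs" for x
  proof (cases "x = 0")
    case False
    then have "x \<in> set bs" using that vs by auto
    then show ?thesis using bs * by blast
  qed simp
  show ?thesis
    by (rule that[OF s, of "length us"]) (auto simp: ds nth_append us' vs')
qed

lemma dc_run_take_Suc:
  "i < length t \<Longrightarrow> dc_run M (take (Suc i) t) = dc_step M (dc_run M (take i t)) (t ! i)"
  by (simp add: dc_run_def take_Suc_conv_app_nth)

text \<open>Up to sign the counter rises from 0 to the turning point and falls afterwards. A return
  to zero lies past the turning point, so a later nonzero value is negative and can only sink
  further.\<close>

lemma no_second_return:
  fixes M :: "('q, 'a) d1ca" and t
  defines "v \<equiv> \<lambda>i. snd (dc_run M (take i t))"
  assumes alt: "alternations (dc_changes M t) \<le> 1"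
    and le: "i < j" "j < k" "k \<le> l" "l \<le> length t"
    and v: "v i \<noteq> 0" "v j = 0" "v k \<noteq> 0"
  shows "v l \<noteq> 0"
proof -
  have len: "length (dc_changes M t) = length t" by (simp add: dc_changes_def)
  have ds: "dc_changes M t ! m = v (Suc m) - v m" if "m < length t" for m
    using that by (simp add: dc_changes_def v_def)
  obtain s r where s: "s = 1 \<or> s = -1"
    and up: "\<And>m. \<lbrakk>m < length t; m < r\<rbrakk> \<Longrightarrow> 0 \<le> s * (v (Suc m) - v m)"
    and down: "\<And>m. \<lbrakk>m < length t; r \<le> m\<rbrakk> \<Longrightarrow> s * (v (Suc m) - v m) \<le> 0"
  proof (rule alternations_le_1[OF alt], goal_cases)
    case (1 s k)
    then show ?case using 1(1)[of s k] len ds by simp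
  qed
  define W where "W m = s * v m" for m
  have inc: "W a \<le> W b" if "a \<le> b" "b \<le> r" "b \<le> length t" for a b
    using that
  proof (induction rule: dec_induct)
    case (step m)
    then show ?case using up[of m] by (simp add: W_def algebra_simps)
  qed simp
  have dec: "W b \<le> W a" if "a \<le> b" "r \<le> a" "b \<le> length t" for a b
    using that
  proof (induction rule: dec_induct)
    case (step m)
    then show ?case using down[of m] by (simp add: W_def algebra_simps)
  qed simp
  have W0: "W m = 0 \<longleftrightarrow> v m = 0" for m using s by (auto simp: W_def)
  have start: "W 0 = 0" by (simp add: W0 v_def dc_run_def)
  \<comment> \<open>Otherwise monotonicity would squeeze \<open>W i\<close> between
    \<open>W 0 = 0\<close> and \<open>W j = 0\<close>.\<close>
  have "r < j"
  proof (rule ccontr)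
    assume "\<not> r < j"
    then have "W 0 \<le> W i" "W i \<le> W j" using inc[of 0 i] inc[of i j] le by auto
    then show False using start W0[of i] W0[of j] v by simp
  qed
  then have "W k \<le> W j" "W l \<le> W k" using dec[of j k] dec[of k l] le by auto
  then show ?thesis using W0[of j] W0[of k] W0[of l] v by auto
qed

section \<open>Correctness of the simulation\<close>

lemma sim_correct:
  assumes M: "one_rev_rt_d1ca M" and w: "w \<in> lists (dc_alphabet M)"
  shows "qc_prob (sim_qfa M) w > 1 / 2 \<longleftrightarrow> fst (dc_run M (tape w)) \<in> dc_accept M"
proof -
  define t where "t = tape w"
  define n where "n = length t"
  define q where "q i = fst (dc_run M (take i t))" for i
  define v where "v i = snd (dc_run M (take i t))" for i
  define acc where "acc \<longleftrightarrow> q n \<in> dc_accept M"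
  have rt: "rt_d1ca M" and alt: "alternations (dc_changes M t) \<le> 1"
    using M w by (auto simp: one_rev_rt_d1ca_def t_def)
  have syms: "set t \<subseteq> tape_syms (dc_alphabet M)"
    using w by (auto simp: t_def tape_def tape_syms_def)
  have dsyms: "set (drop i t) \<subseteq> tape_syms (dc_alphabet M)" for i
    using syms set_drop_subset by fast
  have qS: "q (Suc i) = dc_delta M (q i) (t ! i) (v i \<noteq> 0)"
    and vS: "v (Suc i) = v i + dc_update M (q (Suc i))" if "i < n" for i
    using that by (simp_all add: q_def v_def n_def dc_run_take_Suc dc_step_def Let_def case_prod_beta)
  have dr: "drop i t = t ! i # drop (Suc i) t" if "i < n" for i
    using that by (simp add: n_def Cons_nth_drop_Suc)
  have drn: "drop n t = []" by (simp add: n_def)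
  have start: "q 0 = dc_init M" "v 0 = 0" by (simp_all add: q_def v_def dc_run_def)
  have qst: "q i \<in> dc_states M" if "i \<le> n" for i
    using that
  proof (induction i)
    case 0
    then show ?case using rt by (simp add: start rt_d1ca_def)
  next
    case (Suc i)
    then have "t ! i \<in> tape_syms (dc_alphabet M)" using syms by (auto simp: n_def dest: nth_mem)
    then show ?case using Suc rt by (simp add: qS delta_states)
  qed
  have away: "guess_accepts M True (q i) (drop i t) = acc"
    if "i \<le> n" "\<forall>j. i \<le> j \<and> j \<le> n \<longrightarrow> v j \<noteq> 0" for i
    using that
  proof (induction rule: inc_induct)
    case base
    then show ?case by (simp add: drn acc_def)
  next
    case (step m)
    then show ?case using qS[of m] by (simp add: dr Let_def)
  qed
  \<comment> \<open>After a genuine return the status bit is right: it stays false while the counter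
    rests at zero, and once the counter leaves, \<open>no_second_return\<close> reduces to
    \<open>away\<close>.\<close>
  have returned: "guess_accepts M False (q j) (drop j t) = acc"
    if "j \<le> n" "\<exists>i<j. v i \<noteq> 0" "v j = 0" for j
    using that
  proof (induction rule: inc_induct)
    case base
    then show ?case by (simp add: drn acc_def)
  next
    case (step m)
    obtain i where i: "i < m" "v i \<noteq> 0" using step.prems by blast
    have eq: "guess_accepts M False (q m) (drop m t)
      = guess_accepts M (v (Suc m) \<noteq> 0) (q (Suc m)) (drop (Suc m) t)"
      using step.hyps step.prems qS[of m] vS[of m] by (simp add: dr Let_def)
    show ?case
    proof (cases "v (Suc m) = 0")
      case True
      then show ?thesis using eq step.IH i less_Suc_eq by auto
    next
      case False
      have "v l \<noteq> 0" if "Suc m \<le> l" "l \<le> n" for l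
        using no_second_return[OF alt i(1), of "Suc m" l] that i step.prems False
        by (simp add: v_def n_def)
      then show ?thesis using eq away[of "Suc m"] step.hyps False by auto
    qed
  qed
  \<comment> \<open>Backward induction. Without a return at the next position the bias is just
    divided by 3 and keeps its sign; at a return the correct guess contributes 1 or -1 against a
    remainder of at most 1/2.\<close>
  have sgn_bias: "bias M (q i) (v i) (drop i t) \<noteq> 0 \<and> (bias M (q i) (v i) (drop i t) > 0 \<longleftrightarrow> acc)"
    if "i \<le> n" "v i \<noteq> 0" for i
    using that
  proof (induction rule: inc_induct)
    case base
    then show ?case by (simp add: drn acc_def sg_def)
  next
    case (step m)
    let ?b = "bias M (q (Suc m)) (v (Suc m)) (drop (Suc m) t)"
    have eq: "bias M (q m) (v m) (drop m t)
      = (?b + of_bool (v (Suc m) = 0) * sg (guess_accepts M False (q (Suc m)) (drop (Suc m) t))) / 3"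
      using step.hyps step.prems qS[of m] vS[of m] by (simp add: dr Let_def)
    show ?case
    proof (cases "v (Suc m) = 0")
      case True
      moreover have "guess_accepts M False (q (Suc m)) (drop (Suc m) t) = acc"
        using returned[of "Suc m"] True step by auto
      moreover have "\<bar>?b\<bar> \<le> 1 / 2" by (rule abs_bias_le)
      ultimately show ?thesis using eq by (auto simp: sg_def)
    next
      case False
      then show ?thesis using eq step.IH by auto
    qed
  qed
  \<comment> \<open>If the counter stays at zero to the end, the probability is 1 or 0. Otherwise
    the first nonzero update yields 1/2 plus a bias whose sign gives the answer.\<close>
  have zero: "Re (foldr (heis (sim_qfa M)) (drop i t) (acc_obs (sim_qfa M)) (Zero (q i), 0) (Zero (q i), 0)) > 1 / 2
      \<longleftrightarrow> acc"
    if "i \<le> n" "v i = 0" for i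
    using that
  proof (induction rule: inc_induct)
    case base
    then show ?case by (simp add: drn acc_def acc_obs_def)
  next
    case (step m)
    have eq: "foldr (heis (sim_qfa M)) (drop m t) (acc_obs (sim_qfa M)) (Zero (q m), 0) (Zero (q m), 0)
      = (if v (Suc m) = 0 then foldr (heis (sim_qfa M)) (drop (Suc m) t) (acc_obs (sim_qfa M))
            (Zero (q (Suc m)), 0) (Zero (q (Suc m)), 0)
         else 1 / 2 + complex_of_real (bias M (q (Suc m)) (v (Suc m)) (drop (Suc m) t)))"
      using observed_Zero[OF rt, of "t ! m" "drop (Suc m) t" "q m" 0] dsyms[of m] qst[of m]
        step.hyps step.prems qS[of m] vS[of m] by (simp add: dr)
    show ?case using eq sgn_bias[of "Suc m"] step by auto
  qed
  have "qc_prob (sim_qfa M) w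
    = Re (foldr (heis (sim_qfa M)) (drop 0 t) (acc_obs (sim_qfa M)) (Zero (q 0), 0) (Zero (q 0), 0))"
    using qc_prob_heis[of "sim_qfa M" w] finite_sim_states[OF rt] rt
    by (simp add: start t_def rt_d1ca_def)
  moreover have "acc \<longleftrightarrow> fst (dc_run M (tape w)) \<in> dc_accept M"
    by (simp add: acc_def q_def n_def t_def)
  ultimately show ?thesis using zero[of 0] start by simp
qed

theorem theorem4:
  fixes M :: "('q, 'a) d1ca" and L :: "'a list set"
  assumes "one_rev_rt_d1ca M"
    and "L = dc_lang M"
  shows "\<exists>N :: (nat, 'a, nat) qfa_ioc.
           rt_qfa_ioc N \<and> qc_alphabet N = dc_alphabet M \<and>
           qc_recognizes_with_cutpoint N (1 / 2) L"
proof -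
  have rt: "rt_d1ca M" using assms by (simp add: one_rev_rt_d1ca_def)
  obtain N :: "(nat, 'a, nat) qfa_ioc" where "rt_qfa_ioc N"
    "qc_alphabet N = qc_alphabet (sim_qfa M)" "\<And>w. qc_prob N w = qc_prob (sim_qfa M) w"
  proof (rule nat_machine[of "sim_qfa M"])
    show "qc_accept (sim_qfa M) \<subseteq> qc_states (sim_qfa M)"
      using rt by (auto simp: sim_accept_def rt_d1ca_def)
  next
    show "heis (sim_qfa M) \<sigma> kron (q, v) (p, u) = kron (q, v) (p, u)"
      if "\<sigma> \<in> tape_syms (qc_alphabet (sim_qfa M))" "q \<in> qc_states (sim_qfa M)"
        "p \<in> qc_states (sim_qfa M)" for \<sigma> q p v u
      using that heis_sim_kron[OF rt] by simp
  qed (use rt finite_sim_states[OF rt] in \<open>simp_all add: rt_d1ca_def\<close>)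
  then show ?thesis
    using sim_correct[OF assms(1)] assms(2)
    by (intro exI[of _ N]) (auto simp: qc_recognizes_with_cutpoint_def dc_lang_def)
qed

end
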